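(* Let $X$ be a quandle, $k$ a field, and $\theta$ a quandle $3$-cocycle of $X$ with coefficient group $A=k$. Let $W=k\oplus kX$ with its coalgebra structure and map $q:W\otimes W\to W$ described in the context. Define a linear map $\hat\theta:W\otimes W\otimes W\to W$ by linearly extending $\hat\theta(x\otimes y\otimes z)=\theta(x,y,z)\in k\subset W$, $\hat\theta(1\otimes y\otimes z)=1$, and $$\hat\theta(x\otimes y\otimes 1)=\hat\theta(x\otimes 1\otimes z)=\hat\theta(x\otimes 1\otimes 1)=\hat\theta(1\otimes y\otimes 1)=\hat\theta(1\otimes 1\otimes z)=\hat\theta(1\otimes 1\otimes 1)=0$$ for $x,y,z\in X$. Then $\hat\theta$ is a shelf $3$-cocycle: $d^{3,1}(\hat\theta,0,0)=0$.
   Context: A quandle is a set $X$ with a binary operation $\triangleleft$ such that $a\triangleleft a=a$; for all $a,b$ there is a unique $c$ with $a=c\triangleleft b$; and $(a\triangleleft b)\triangleleft c=(a\triangleleft c)\triangleleft(b\triangleleft c)$. A quandle $3$-cocycle with coefficients in $k$ is a function $\theta:X^3\to k$ with $$\theta(x,y,z)+\theta(x\triangleleft z,y\triangleleft z,w)+\theta(x,z,w)=\theta(x\triangleleft y,z,w)+\theta(x,y,w)+\theta(x\triangleleft w,y\triangleleft w,z\triangleleft w)$$ and $\theta(x,x,y)=\theta(x,y,y)=0$ for all $x,y,z,w\in X$. $W=k\oplus kX$ ($kX$ the vector space with basis $X$) is the coalgebra with $\Delta(1)=1\otimes 1$, $\Delta(x)=x\otimes x$, $\epsilon(1)=1$,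 $\epsilon(x)=1$ ($1\in k$, $x\in X$), and $q:W\otimes W\to W$ is the linear map with $q(x\otimes y)=x\triangleleft y$, $q(1\otimes x)=1$, $q(x\otimes 1)=0$, $q(1\otimes 1)=0$. For a linear map $\xi:W^{\otimes 3}\to W$, the map $d^{3,1}(\xi,0,0):W^{\otimes 4}\to W$ is given, in Sweedler notation, by $$\begin{aligned}d^{3,1}(\xi,0,0)(a\otimes b\otimes c\otimes d)=\;& q\big(\xi(a\otimes b\otimes c)\otimes d\big)+\xi\big(q(a\otimes c_{(1)})\otimes q(b\otimes c_{(2)})\otimes d\big)\\&+q\big(\xi(a\otimes c_{(1)}\otimes d_{(1)})\otimes q(q(b\otimes c_{(2)})\otimes d_{(2)})\big)\\&+q\big(q(q(a\otimes d_{(1)})\otimes q(c_{(1)}\otimes d_{(2)}))\otimes\xi(b\otimes c_{(2)}\otimes d_{(3)})\big)\\&-\xi\big(q(a\otimes b)\otimes c\otimes d\big)-q\big(\xi(a\otimes b\otimes d_{(1)})\otimes q(c\otimes d_{(2)})\big)\\&-\xi\big(q(a\otimes d_{(1)})\otimes q(b\otimes d_{(2)})\otimes q(c\otimes d_{(3)})\big).\end{aligned}$$ *)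

theory Defs
  imports Complex_Main "HOL-Library.Poly_Mapping"
begin

section \<open>Vector spaces with a basis and their tensor products\<close>

text \<open>
  The vector space over the field \<open>'k\<close> with basis \<open>'b\<close> is the type \<open>'b \<Rightarrow>\<^sub>0 'k\<close> of finitely
  supported functions. The tensor product of the spaces with bases \<open>'b\<close> and \<open>'c\<close> is modelled by
  the space with basis \<open>'b \<times> 'c\<close>, and iterated tensor products are nested to the right.
  Lemmas \<open>linear_tensor_lift2\<close>, \<open>tensor_lift2_tensor\<close> and \<open>linear_eq_on_tensor\<close> below
  are the universal property of this model.
\<close>

definition scale :: "'k::field \<Rightarrow> ('b \<Rightarrow>\<^sub>0 'k) \<Rightarrow> ('b \<Rightarrow>\<^sub>0 'k)" where
  "scale c v = Poly_Mapping.map ((*) c) v"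

abbreviation is_linear :: "(('b \<Rightarrow>\<^sub>0 'k::field) \<Rightarrow> ('c \<Rightarrow>\<^sub>0 'k)) \<Rightarrow> bool" where
  "is_linear \<equiv> Vector_Spaces.linear scale scale"

definition bvec :: "'b \<Rightarrow> ('b \<Rightarrow>\<^sub>0 'k::field)" where
  "bvec b = Poly_Mapping.single b 1"

definition lin_ext :: "('b \<Rightarrow> ('c \<Rightarrow>\<^sub>0 'k::field)) \<Rightarrow> ('b \<Rightarrow>\<^sub>0 'k) \<Rightarrow> ('c \<Rightarrow>\<^sub>0 'k)" where
  "lin_ext f v = (\<Sum>b\<in>Poly_Mapping.keys v. scale (Poly_Mapping.lookup v b) (f b))"

lift_definition tensor ::
  "('b \<Rightarrow>\<^sub>0 'k::field) \<Rightarrow> ('c \<Rightarrow>\<^sub>0 'k) \<Rightarrow> ('b \<times> 'c \<Rightarrow>\<^sub>0 'k)" (infixr "\<otimes>" 75)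
  is "\<lambda>u v (b, c). u b * v c"
proof -
  fix u :: "'b \<Rightarrow> 'k" and v :: "'c \<Rightarrow> 'k"
  assume "finite {b. u b \<noteq> 0}" "finite {c. v c \<noteq> 0}"
  then have "finite ({b. u b \<noteq> 0} \<times> {c. v c \<noteq> 0})"
    by simp
  then show "finite {p. (case p of (b, c) \<Rightarrow> u b * v c) \<noteq> 0}"
    by (rule rev_finite_subset) auto
qed

text \<open>
  The linear map on a tensor product induced by a multilinear map \<open>F\<close>. The values of \<open>F\<close> on basis
  vectors determine it.
\<close>

definition tensor_lift2 ::
  "(('a \<Rightarrow>\<^sub>0 'k::field) \<Rightarrow> ('b \<Rightarrow>\<^sub>0 'k) \<Rightarrow> ('e \<Rightarrow>\<^sub>0 'k)) \<Rightarrow> ('a \<times> 'b \<Rightarrow>\<^sub>0 'k) \<Rightarrow> ('e \<Rightarrow>\<^sub>0 'k)" where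
  "tensor_lift2 F = lin_ext (\<lambda>(i, j). F (bvec i) (bvec j))"

definition tensor_lift3 ::
  "(('a \<Rightarrow>\<^sub>0 'k::field) \<Rightarrow> ('b \<Rightarrow>\<^sub>0 'k) \<Rightarrow> ('c \<Rightarrow>\<^sub>0 'k) \<Rightarrow> ('e \<Rightarrow>\<^sub>0 'k))
    \<Rightarrow> ('a \<times> 'b \<times> 'c \<Rightarrow>\<^sub>0 'k) \<Rightarrow> ('e \<Rightarrow>\<^sub>0 'k)" where
  "tensor_lift3 F = lin_ext (\<lambda>(i, j, l). F (bvec i) (bvec j) (bvec l))"

definition tensor_lift4 ::
  "(('a \<Rightarrow>\<^sub>0 'k::field) \<Rightarrow> ('b \<Rightarrow>\<^sub>0 'k) \<Rightarrow> ('c \<Rightarrow>\<^sub>0 'k) \<Rightarrow> ('d \<Rightarrow>\<^sub>0 'k) \<Rightarrow> ('e \<Rightarrow>\<^sub>0 'k))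
    \<Rightarrow> ('a \<times> 'b \<times> 'c \<times> 'd \<Rightarrow>\<^sub>0 'k) \<Rightarrow> ('e \<Rightarrow>\<^sub>0 'k)" where
  "tensor_lift4 F = lin_ext (\<lambda>(i, j, l, m). F (bvec i) (bvec j) (bvec l) (bvec m))"

section \<open>Sweedler notation and the differential\<close>

text \<open>
  For a comultiplication \<open>\<Delta>\<close>, the Sweedler expressions \<open>F(c\<^sub>(\<^sub>1\<^sub>), c\<^sub>(\<^sub>2\<^sub>))\<close> and
  \<open>F(c\<^sub>(\<^sub>1\<^sub>), c\<^sub>(\<^sub>2\<^sub>), c\<^sub>(\<^sub>3\<^sub>))\<close> are the values of the linear map induced by \<open>F\<close> at
  \<open>\<Delta> c\<close> and at \<open>(id \<otimes> \<Delta>) (\<Delta> c)\<close>.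
\<close>

definition sweedler2 ::
  "(('b \<Rightarrow>\<^sub>0 'k::field) \<Rightarrow> ('b \<times> 'b \<Rightarrow>\<^sub>0 'k)) \<Rightarrow> ('b \<Rightarrow>\<^sub>0 'k)
    \<Rightarrow> (('b \<Rightarrow>\<^sub>0 'k) \<Rightarrow> ('b \<Rightarrow>\<^sub>0 'k) \<Rightarrow> ('e \<Rightarrow>\<^sub>0 'k)) \<Rightarrow> ('e \<Rightarrow>\<^sub>0 'k)" where
  "sweedler2 \<Delta> c F = tensor_lift2 F (\<Delta> c)"

definition sweedler3 ::
  "(('b \<Rightarrow>\<^sub>0 'k::field) \<Rightarrow> ('b \<times> 'b \<Rightarrow>\<^sub>0 'k)) \<Rightarrow> ('b \<Rightarrow>\<^sub>0 'k)
    \<Rightarrow> (('b \<Rightarrow>\<^sub>0 'k) \<Rightarrow> ('b \<Rightarrow>\<^sub>0 'k) \<Rightarrow> ('b \<Rightarrow>\<^sub>0 'k) \<Rightarrow> ('e \<Rightarrow>\<^sub>0 'k)) \<Rightarrow> ('e \<Rightarrow>\<^sub>0 'k)" where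
  "sweedler3 \<Delta> c F = tensor_lift3 F (tensor_lift2 (\<lambda>u v. u \<otimes> \<Delta> v) (\<Delta> c))"

text \<open>
  The map \<open>d\<^sup>3\<^sup>,\<^sup>1(\<xi>, 0, 0) : W\<^sup>\<otimes>\<^sup>4 \<rightarrow> W\<close>. Lemma \<open>d31_tensor\<close> shows that it is given by the same
  formula on all pure tensors.
\<close>

definition d31 ::
  "(('b \<Rightarrow>\<^sub>0 'k::field) \<Rightarrow> ('b \<times> 'b \<Rightarrow>\<^sub>0 'k)) \<Rightarrow> (('b \<times> 'b \<Rightarrow>\<^sub>0 'k) \<Rightarrow> ('b \<Rightarrow>\<^sub>0 'k))
    \<Rightarrow> (('b \<times> 'b \<times> 'b \<Rightarrow>\<^sub>0 'k) \<Rightarrow> ('b \<Rightarrow>\<^sub>0 'k))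
    \<Rightarrow> ('b \<times> 'b \<times> 'b \<times> 'b \<Rightarrow>\<^sub>0 'k) \<Rightarrow> ('b \<Rightarrow>\<^sub>0 'k)" where
  "d31 \<Delta> q \<xi> = tensor_lift4 (\<lambda>a b c d.
      q (\<xi> (a \<otimes> b \<otimes> c) \<otimes> d)
    + sweedler2 \<Delta> c (\<lambda>c1 c2. \<xi> (q (a \<otimes> c1) \<otimes> q (b \<otimes> c2) \<otimes> d))
    + sweedler2 \<Delta> c (\<lambda>c1 c2. sweedler2 \<Delta> d (\<lambda>d1 d2.
        q (\<xi> (a \<otimes> c1 \<otimes> d1) \<otimes> q (q (b \<otimes> c2) \<otimes> d2))))
    + sweedler2 \<Delta> c (\<lambda>c1 c2. sweedler3 \<Delta> d (\<lambda>d1 d2 d3.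
        q (q (q (a \<otimes> d1) \<otimes> q (c1 \<otimes> d2)) \<otimes> \<xi> (b \<otimes> c2 \<otimes> d3))))
    - \<xi> (q (a \<otimes> b) \<otimes> c \<otimes> d)
    - sweedler2 \<Delta> d (\<lambda>d1 d2. q (\<xi> (a \<otimes> b \<otimes> d1) \<otimes> q (c \<otimes> d2)))
    - sweedler3 \<Delta> d (\<lambda>d1 d2 d3. \<xi> (q (a \<otimes> d1) \<otimes> q (b \<otimes> d2) \<otimes> q (c \<otimes> d3))))"

section \<open>Quandles and their cocycles\<close>

locale quandle =
  fixes qop :: "'x \<Rightarrow> 'x \<Rightarrow> 'x" (infixl "\<triangleleft>" 70)
  assumes idem: "a \<triangleleft> a = a"
    and unique_left: "\<exists>!c. a = c \<triangleleft> b"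
    and distrib: "(a \<triangleleft> b) \<triangleleft> c = (a \<triangleleft> c) \<triangleleft> (b \<triangleleft> c)"

definition quandle_3cocycle ::
  "('x \<Rightarrow> 'x \<Rightarrow> 'x) \<Rightarrow> ('x \<Rightarrow> 'x \<Rightarrow> 'x \<Rightarrow> 'k::ab_group_add) \<Rightarrow> bool" where
  "quandle_3cocycle qop \<theta> \<longleftrightarrow>
    (\<forall>x y z w. \<theta> x y z + \<theta> (qop x z) (qop y z) w + \<theta> x z w
      = \<theta> (qop x y) z w + \<theta> x y w + \<theta> (qop x w) (qop y w) (qop z w))
    \<and> (\<forall>x y. \<theta> x x y = 0 \<and> \<theta> x y y = 0)"

section \<open>The coalgebra \<open>W = k \<oplus> kX\<close>\<close>

text \<open>
  The basis of \<open>W\<close> is \<open>'x option\<close>: \<open>None\<close> stands for the element 1 of the summand \<open>k\<close>, and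
  \<open>Some x\<close> for \<open>x \<in> X\<close>.
\<close>

definition of_scalar :: "'k::field \<Rightarrow> ('x option \<Rightarrow>\<^sub>0 'k)" where
  "of_scalar c = Poly_Mapping.single None c"

definition of_elem :: "'x \<Rightarrow> ('x option \<Rightarrow>\<^sub>0 'k::field)" where
  "of_elem x = bvec (Some x)"

definition W_comult :: "('x option \<Rightarrow>\<^sub>0 'k::field) \<Rightarrow> ('x option \<times> 'x option \<Rightarrow>\<^sub>0 'k)" where
  "W_comult = lin_ext (\<lambda>b. case b of
      None \<Rightarrow> of_scalar 1 \<otimes> of_scalar 1
    | Some x \<Rightarrow> of_elem x \<otimes> of_elem x)"

definition W_counit :: "('x option \<Rightarrow>\<^sub>0 'k::field) \<Rightarrow> 'k" where
  "W_counit v = (\<Sum>b\<in>Poly_Mapping.keys v. Poly_Mapping.lookup v b)"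

definition W_q ::
  "('x \<Rightarrow> 'x \<Rightarrow> 'x) \<Rightarrow> ('x option \<times> 'x option \<Rightarrow>\<^sub>0 'k::field) \<Rightarrow> ('x option \<Rightarrow>\<^sub>0 'k)" where
  "W_q qop = lin_ext (\<lambda>p. case p of
      (Some x, Some y) \<Rightarrow> of_elem (qop x y)
    | (None, Some y) \<Rightarrow> of_scalar 1
    | (_, None) \<Rightarrow> 0)"

definition theta_hat ::
  "('x \<Rightarrow> 'x \<Rightarrow> 'x \<Rightarrow> 'k::field)
    \<Rightarrow> ('x option \<times> 'x option \<times> 'x option \<Rightarrow>\<^sub>0 'k) \<Rightarrow> ('x option \<Rightarrow>\<^sub>0 'k)" where
  "theta_hat \<theta> = lin_ext (\<lambda>p. case p of
      (Some x, Some y, Some z) \<Rightarrow> of_scalar (\<theta> x y z)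
    | (None, Some y, Some z) \<Rightarrow> of_scalar 1
    | _ \<Rightarrow> 0)"

definition shelf_3cocycle ::
  "('x \<Rightarrow> 'x \<Rightarrow> 'x)
    \<Rightarrow> (('x option \<times> 'x option \<times> 'x option \<Rightarrow>\<^sub>0 'k::field) \<Rightarrow> ('x option \<Rightarrow>\<^sub>0 'k)) \<Rightarrow> bool" where
  "shelf_3cocycle qop \<xi> \<longleftrightarrow> is_linear \<xi> \<and> d31 W_comult (W_q qop) \<xi> = (\<lambda>_. 0)"

section \<open>The definitions behave as intended\<close>

lemma lookup_scale [simp]: "Poly_Mapping.lookup (scale c v) b = c * Poly_Mapping.lookup v b"
  by (simp add: scale_def map.rep_eq when_def)

lemma lookup_tensor [simp]:
  "Poly_Mapping.lookup (u \<otimes> v) (b, c) = Poly_Mapping.lookup u b * Poly_Mapping.lookup v c"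
  by (simp add: tensor.rep_eq)

lemma vector_space_scale: "vector_space scale"
  by unfold_locales (auto intro!: poly_mapping_eqI simp: lookup_add algebra_simps)

lemma module_scale: "module scale"
  by unfold_locales (auto intro!: poly_mapping_eqI simp: lookup_add algebra_simps)

lemma is_linear_iff:
  "is_linear f \<longleftrightarrow> (\<forall>u v. f (u + v) = f u + f v) \<and> (\<forall>c v. f (scale c v) = scale c (f v))"
  by (simp add: Vector_Spaces.linear_def module_hom_def module_hom_axioms_def
      vector_space_scale module_scale)

lemma scale_simps [simp]:
  "scale c (u + v) = scale c u + scale c v"
  "scale c (u - v) = scale c u - scale c v"
  "scale (c + d) u = scale c u + scale d u"
  "scale c (scale d u) = scale (c * d) u"
  "scale 0 u = 0" "scale c 0 = 0" "scale 1 u = u"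
  by (auto intro!: poly_mapping_eqI simp: lookup_add lookup_minus algebra_simps)

lemma scale_sum: "scale c (sum f A) = (\<Sum>a\<in>A. scale c (f a))"
  by (induction A rule: infinite_finite_induct) auto

lemma lin_ext_superset:
  assumes "finite A" "Poly_Mapping.keys v \<subseteq> A"
  shows "lin_ext f v = (\<Sum>b\<in>A. scale (Poly_Mapping.lookup v b) (f b))"
  unfolding lin_ext_def
  by (rule sum.mono_neutral_left[OF assms]) (auto simp: in_keys_iff)

lemma linear_lin_ext:
  fixes f :: "'b \<Rightarrow> ('c \<Rightarrow>\<^sub>0 'k::field)"
  shows "is_linear (lin_ext f)"
  unfolding is_linear_iff
proof (intro conjI allI)
  fix u v :: "'b \<Rightarrow>\<^sub>0 'k" and c :: 'k
  let ?A = "Poly_Mapping.keys u \<union> Poly_Mapping.keys v"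
  have "Poly_Mapping.keys (u + v) \<subseteq> ?A"
    by (rule keys_add)
  then show "lin_ext f (u + v) = lin_ext f u + lin_ext f v"
    by (simp add: lin_ext_superset[of ?A] lookup_add sum.distrib)
  have "Poly_Mapping.keys (scale c v) \<subseteq> Poly_Mapping.keys v"
    by (auto simp: in_keys_iff)
  then show "lin_ext f (scale c v) = scale c (lin_ext f v)"
    by (simp add: lin_ext_superset[of "Poly_Mapping.keys v"] scale_sum)
qed

lemma lin_ext_bvec [simp]: "lin_ext f (bvec b) = f b"
  by (simp add: lin_ext_def bvec_def)

lemma is_linear_sum:
  assumes "is_linear f"
  shows "f (\<Sum>a\<in>A. scale (c a) (g a)) = (\<Sum>a\<in>A. scale (c a) (f (g a)))"
proof -
  have "f 0 = 0"
    using assms unfolding is_linear_iff by (metis scale_simps(5))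
  then show ?thesis
    using assms unfolding is_linear_iff
    by (induction A rule: infinite_finite_induct) auto
qed

lemma bvec_expansion: "v = (\<Sum>b\<in>Poly_Mapping.keys v. scale (Poly_Mapping.lookup v b) (bvec b))"
  by (rule poly_mapping_eqI)
    (auto simp: lookup_sum bvec_def lookup_single when_def in_keys_iff if_distrib sum.delta
      cong: if_cong)

lemma lin_ext_unique:
  assumes "is_linear f" "\<And>b. f (bvec b) = g b"
  shows "f = lin_ext g"
proof
  fix v
  have "f v = f (\<Sum>b\<in>Poly_Mapping.keys v. scale (Poly_Mapping.lookup v b) (bvec b))"
    using bvec_expansion[of v] by simp
  then show "f v = lin_ext g v"
    by (simp add: is_linear_sum[OF assms(1)] assms(2) lin_ext_def)
qed

lemma linear_eq_on_bvec:
  assumes "is_linear f" "is_linear g" "\<And>b. f (bvec b) = g (bvec b)"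
  shows "f = g"
  using lin_ext_unique[OF assms(1,3)] lin_ext_unique[OF assms(2) refl] by simp

named_theorems lin_intros

lemma linear_id [lin_intros]: "is_linear (\<lambda>x. x)"
  by (simp add: is_linear_iff)

lemma linear_add [lin_intros]:
  "is_linear f \<Longrightarrow> is_linear g \<Longrightarrow> is_linear (\<lambda>x. f x + g x)"
  by (simp add: is_linear_iff algebra_simps)

lemma linear_diff [lin_intros]:
  "is_linear f \<Longrightarrow> is_linear g \<Longrightarrow> is_linear (\<lambda>x. f x - g x)"
  by (simp add: is_linear_iff algebra_simps)

lemma linear_comp: "is_linear f \<Longrightarrow> is_linear g \<Longrightarrow> is_linear (\<lambda>x. f (g x))"
  by (simp add: is_linear_iff)

lemma linear_tensor_left [lin_intros]: "is_linear f \<Longrightarrow> is_linear (\<lambda>x. f x \<otimes> v)"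
  by (auto simp: is_linear_iff lookup_add algebra_simps intro!: poly_mapping_eqI)

lemma linear_tensor_right [lin_intros]: "is_linear f \<Longrightarrow> is_linear (\<lambda>x. u \<otimes> f x)"
  by (auto simp: is_linear_iff lookup_add algebra_simps intro!: poly_mapping_eqI)

lemma bvec_tensor [simp]: "bvec i \<otimes> bvec j = bvec (i, j)"
  by (rule poly_mapping_eqI) (auto simp: bvec_def lookup_single when_def split: if_splits)

lemma linear_tensor_lift2: "is_linear (tensor_lift2 F)"
  unfolding tensor_lift2_def by (rule linear_lin_ext)

lemma tensor_lift2_tensor:
  assumes "\<And>v. is_linear (\<lambda>u. F u v)" "\<And>u. is_linear (F u)"
  shows "tensor_lift2 F (u \<otimes> v) = F u v"
proof -
  have b: "(\<lambda>v. tensor_lift2 F (bvec i \<otimes> v)) = F (bvec i)" for i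
    by (rule linear_eq_on_bvec)
      (auto simp: tensor_lift2_def assms intro!: linear_comp[OF linear_lin_ext] lin_intros)
  have "(\<lambda>u. tensor_lift2 F (u \<otimes> v)) = (\<lambda>u. F u v)"
    by (rule linear_eq_on_bvec)
      (auto simp: assms b[THEN fun_cong] intro!: linear_comp[OF linear_tensor_lift2] lin_intros)
  then show ?thesis
    by (rule fun_cong)
qed

lemma linear_eq_on_tensor:
  assumes "is_linear f" "is_linear g" "\<And>u v. f (u \<otimes> v) = g (u \<otimes> v)"
  shows "f = g"
  using assms by (intro linear_eq_on_bvec) (auto simp flip: bvec_tensor)

lemma tensor_lift4_tensor:
  assumes "\<And>b c d. is_linear (\<lambda>a. F a b c d)" "\<And>a c d. is_linear (\<lambda>b. F a b c d)"
    "\<And>a b d. is_linear (\<lambda>c. F a b c d)" "\<And>a b c. is_linear (\<lambda>d. F a b c d)"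
  shows "tensor_lift4 F (a \<otimes> b \<otimes> c \<otimes> d) = F a b c d"
proof -
  note [intro!] = lin_intros linear_comp[OF linear_lin_ext] assms
  let ?L = "tensor_lift4 F"
  have 1: "?L (bvec i \<otimes> bvec j \<otimes> bvec l \<otimes> d) = F (bvec i) (bvec j) (bvec l) d" for i j l d
    by (rule fun_cong[of "\<lambda>d. ?L (bvec i \<otimes> bvec j \<otimes> bvec l \<otimes> d)"], rule linear_eq_on_bvec)
      (auto simp: tensor_lift4_def)
  have 2: "?L (bvec i \<otimes> bvec j \<otimes> c \<otimes> d) = F (bvec i) (bvec j) c d" for i j c d
    by (rule fun_cong[of "\<lambda>c. ?L (bvec i \<otimes> bvec j \<otimes> c \<otimes> d)"], rule linear_eq_on_bvec)
      (use 1 in \<open>auto simp: tensor_lift4_def\<close>)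
  have 3: "?L (bvec i \<otimes> b \<otimes> c \<otimes> d) = F (bvec i) b c d" for i b c d
    by (rule fun_cong[of "\<lambda>b. ?L (bvec i \<otimes> b \<otimes> c \<otimes> d)"], rule linear_eq_on_bvec)
      (use 2 in \<open>auto simp: tensor_lift4_def\<close>)
  show ?thesis
    by (rule fun_cong[of "\<lambda>a. ?L (a \<otimes> b \<otimes> c \<otimes> d)"], rule linear_eq_on_bvec)
      (use 3 in \<open>auto simp: tensor_lift4_def\<close>)
qed

lemma linear_lin_ext_param:
  assumes "\<And>i. is_linear (\<lambda>x. f x i)"
  shows "is_linear (\<lambda>x. lin_ext (f x) t)"
  using assms unfolding is_linear_iff lin_ext_def
  by (simp add: sum.distrib scale_sum mult.commute)

lemma linear_sweedler_param [lin_intros]: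
  "(\<And>u v. is_linear (\<lambda>x. F2 x u v)) \<Longrightarrow> is_linear (\<lambda>x. sweedler2 \<Delta> c (F2 x))"
  "(\<And>u v w. is_linear (\<lambda>x. F3 x u v w)) \<Longrightarrow> is_linear (\<lambda>x. sweedler3 \<Delta> c (F3 x))"
  unfolding sweedler2_def sweedler3_def tensor_lift2_def[of "F2 _"] tensor_lift3_def
  by (auto intro!: linear_lin_ext_param)

lemma linear_sweedler [lin_intros]:
  "is_linear \<Delta> \<Longrightarrow> is_linear (\<lambda>x. sweedler2 \<Delta> x F2)"
  "is_linear \<Delta> \<Longrightarrow> is_linear (\<lambda>x. sweedler3 \<Delta> x F3)"
  unfolding sweedler2_def sweedler3_def tensor_lift2_def tensor_lift3_def
  by (auto intro!: linear_comp[OF linear_lin_ext])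

lemma d31_tensor:
  assumes "is_linear \<Delta>" and q: "is_linear q" and xi: "is_linear \<xi>"
  shows "d31 \<Delta> q \<xi> (a \<otimes> b \<otimes> c \<otimes> d) =
      q (\<xi> (a \<otimes> b \<otimes> c) \<otimes> d)
    + sweedler2 \<Delta> c (\<lambda>c1 c2. \<xi> (q (a \<otimes> c1) \<otimes> q (b \<otimes> c2) \<otimes> d))
    + sweedler2 \<Delta> c (\<lambda>c1 c2. sweedler2 \<Delta> d (\<lambda>d1 d2.
        q (\<xi> (a \<otimes> c1 \<otimes> d1) \<otimes> q (q (b \<otimes> c2) \<otimes> d2))))
    + sweedler2 \<Delta> c (\<lambda>c1 c2. sweedler3 \<Delta> d (\<lambda>d1 d2 d3.
        q (q (q (a \<otimes> d1) \<otimes> q (c1 \<otimes> d2)) \<otimes> \<xi> (b \<otimes> c2 \<otimes> d3))))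
    - \<xi> (q (a \<otimes> b) \<otimes> c \<otimes> d)
    - sweedler2 \<Delta> d (\<lambda>d1 d2. q (\<xi> (a \<otimes> b \<otimes> d1) \<otimes> q (c \<otimes> d2)))
    - sweedler3 \<Delta> d (\<lambda>d1 d2 d3. \<xi> (q (a \<otimes> d1) \<otimes> q (b \<otimes> d2) \<otimes> q (c \<otimes> d3)))"
  unfolding d31_def
  by (rule tensor_lift4_tensor) (intro lin_intros linear_comp[OF q] linear_comp[OF xi] assms)+

lemma W_comult_simps [simp]:
  "W_comult (of_scalar 1) = of_scalar 1 \<otimes> of_scalar 1"
  "W_comult (of_elem x) = of_elem x \<otimes> of_elem x"
  unfolding W_comult_def of_scalar_def of_elem_def by (simp_all flip: bvec_def)

lemma W_counit_simps [simp]: "W_counit (of_scalar 1) = 1" "W_counit (of_elem x) = 1"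
  by (simp_all add: W_counit_def of_scalar_def of_elem_def bvec_def)

lemma linear_W_comult: "is_linear W_comult"
  by (simp add: W_comult_def linear_lin_ext)

lemma W_comult_bvec: "W_comult (bvec b) = bvec b \<otimes> bvec b"
  by (cases b) (simp_all add: W_comult_def of_scalar_def of_elem_def flip: bvec_def)

lemma W_coassoc:
  "tensor_lift2 (\<lambda>u v. u \<otimes> W_comult v) (W_comult c)
    = lin_ext (\<lambda>((i, j), l). bvec (i, j, l)) (tensor_lift2 (\<lambda>u v. W_comult u \<otimes> v) (W_comult c))"
proof (rule fun_cong[of _ _ c], rule linear_eq_on_bvec)
  show "is_linear (\<lambda>c. tensor_lift2 (\<lambda>u v. u \<otimes> W_comult v) (W_comult c))"
    by (intro linear_comp[OF linear_tensor_lift2] linear_W_comult)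
  show "is_linear (\<lambda>c. lin_ext (\<lambda>((i, j), l). bvec (i, j, l))
      (tensor_lift2 (\<lambda>u v. W_comult u \<otimes> v) (W_comult c)))"
    by (intro linear_comp[OF linear_lin_ext] linear_comp[OF linear_tensor_lift2] linear_W_comult)
qed (simp add: W_comult_bvec tensor_lift2_def)

lemma W_counit_left: "tensor_lift2 (\<lambda>u v. scale (W_counit u) v) (W_comult c) = c"
  and W_counit_right: "tensor_lift2 (\<lambda>u v. scale (W_counit v) u) (W_comult c) = c"
proof -
  have [simp]: "W_counit (bvec b :: 'a option \<Rightarrow>\<^sub>0 'b) = 1" for b
    by (simp add: W_counit_def bvec_def)
  show "tensor_lift2 (\<lambda>u v. scale (W_counit u) v) (W_comult c) = c"
    by (rule fun_cong[of _ "\<lambda>c. c"], rule linear_eq_on_bvec)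
      (simp_all add: linear_comp[OF linear_lin_ext] linear_W_comult linear_id
        W_comult_bvec tensor_lift2_def)
  show "tensor_lift2 (\<lambda>u v. scale (W_counit v) u) (W_comult c) = c"
    by (rule fun_cong[of _ "\<lambda>c. c"], rule linear_eq_on_bvec)
      (simp_all add: linear_comp[OF linear_lin_ext] linear_W_comult linear_id
        W_comult_bvec tensor_lift2_def)
qed

lemma W_q_simps [simp]:
  "W_q qop (of_elem x \<otimes> of_elem y) = of_elem (qop x y)"
  "W_q qop (of_scalar 1 \<otimes> of_elem x) = of_scalar 1"
  "W_q qop (of_elem x \<otimes> of_scalar 1) = 0"
  "W_q qop (of_scalar 1 \<otimes> of_scalar 1) = 0"
  unfolding W_q_def of_scalar_def of_elem_def by (simp_all flip: bvec_def)

lemma theta_hat_simps [simp]: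
  "theta_hat \<theta> (of_elem x \<otimes> of_elem y \<otimes> of_elem z) = of_scalar (\<theta> x y z)"
  "theta_hat \<theta> (of_scalar 1 \<otimes> of_elem y \<otimes> of_elem z) = of_scalar 1"
  "theta_hat \<theta> (of_elem x \<otimes> of_elem y \<otimes> of_scalar 1) = 0"
  "theta_hat \<theta> (of_elem x \<otimes> of_scalar 1 \<otimes> of_elem z) = 0"
  "theta_hat \<theta> (of_elem x \<otimes> of_scalar 1 \<otimes> of_scalar 1) = 0"
  "theta_hat \<theta> (of_scalar 1 \<otimes> of_elem y \<otimes> of_scalar 1) = 0"
  "theta_hat \<theta> (of_scalar 1 \<otimes> of_scalar 1 \<otimes> of_elem z) = 0"
  "theta_hat \<theta> (of_scalar 1 \<otimes> of_scalar 1 \<otimes> of_scalar 1) = 0"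
  unfolding theta_hat_def of_elem_def of_scalar_def[of 1] by (simp_all flip: bvec_def)

lemma linear_W_q: "is_linear (W_q qop)"
  and linear_theta_hat: "is_linear (theta_hat \<theta>)"
  by (simp_all add: W_q_def theta_hat_def linear_lin_ext)

end

theory Submission
  imports Defs
begin

text \<open>
  Write \<open>\<theta>'\<close> for the extension of \<open>\<theta>\<close> to \<open>W\<^sup>\<otimes>\<^sup>3\<close>. The map \<open>d\<^sup>3\<^sup>,\<^sup>1(\<theta>', 0, 0)\<close> is linear,
  so it suffices to evaluate it on tensors \<open>a \<otimes> b \<otimes> c \<otimes> d\<close> of the basis vectors \<open>1\<close> and \<open>x \<in> X\<close>.
  These are grouplike, so all Sweedler components of \<open>c\<close> are \<open>c\<close> and those of \<open>d\<close> are \<open>d\<close>.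

  Two features of the maps do the work. The map \<open>\<theta>'\<close> takes values in the summand \<open>k\<close> of \<open>W\<close>, on
  which \<open>q(- \<otimes> y)\<close> is the identity for \<open>y \<in> X\<close> while \<open>q(w \<otimes> -)\<close> vanishes
  (lemmas \<open>W_q_scalar_elem\<close> and \<open>W_q_scalar_right\<close>). Hence the fourth term is zero, and for
  \<open>b, c, d \<in> X\<close> the outer \<open>q\<close> disappears from the first, third and sixth terms.

  On \<open>a, b, c, d \<in> X\<close> the remaining six terms are, with their signs, exactly the two sides
  of the quandle cocycle condition. For \<open>a = 1\<close> and \<open>b, c, d \<in> X\<close> each of these six terms equals
  \<open>1\<close>, and three have each sign. If one of \<open>b, c, d\<close> is \<open>1\<close>, all terms vanish: both \<open>q\<close> and
  \<open>\<theta>'\<close> vanish as soon as an argument other than the first is \<open>1\<close>, and \<open>q(1 \<otimes> y) = 1\<close> for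
  \<open>y \<in> X\<close> carries a \<open>1\<close> inside a nested \<open>q\<close> to such a position.
\<close>

text \<open>Basis vectors of \<open>W\<close> are grouplike, so Sweedler sums over them have a single summand.\<close>

lemma sweedler_W_comult_bvec:
  "sweedler2 W_comult (bvec b) F = F (bvec b) (bvec b)"
  "sweedler3 W_comult (bvec b) G = G (bvec b) (bvec b) (bvec b)"
  by (simp_all add: sweedler2_def sweedler3_def tensor_lift2_def tensor_lift3_def W_comult_bvec)

lemma d31_W_bvec:
  fixes a b c d :: "'x option"
  shows "d31 W_comult q \<xi> (bvec (a, b, c, d)) =
      q (\<xi> (bvec a \<otimes> bvec b \<otimes> bvec c) \<otimes> bvec d)
    + \<xi> (q (bvec a \<otimes> bvec c) \<otimes> q (bvec b \<otimes> bvec c) \<otimes> bvec d)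
    + q (\<xi> (bvec a \<otimes> bvec c \<otimes> bvec d) \<otimes> q (q (bvec b \<otimes> bvec c) \<otimes> bvec d))
    + q (q (q (bvec a \<otimes> bvec d) \<otimes> q (bvec c \<otimes> bvec d)) \<otimes> \<xi> (bvec b \<otimes> bvec c \<otimes> bvec d))
    - \<xi> (q (bvec a \<otimes> bvec b) \<otimes> bvec c \<otimes> bvec d)
    - q (\<xi> (bvec a \<otimes> bvec b \<otimes> bvec d) \<otimes> q (bvec c \<otimes> bvec d))
    - \<xi> (q (bvec a \<otimes> bvec d) \<otimes> q (bvec b \<otimes> bvec d) \<otimes> q (bvec c \<otimes> bvec d))"
  by (simp add: d31_def tensor_lift4_def sweedler_W_comult_bvec del: bvec_tensor)

lemma linear_zero: "is_linear f \<Longrightarrow> f 0 = 0"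
  unfolding is_linear_iff by (metis scale_simps(5))

lemma tensor_zero: "0 \<otimes> v = 0" "u \<otimes> 0 = 0"
  by (auto intro!: poly_mapping_eqI)

lemma bvec_option: "bvec None = of_scalar 1" "bvec (Some x) = of_elem x"
  by (simp_all add: bvec_def of_scalar_def of_elem_def)

lemma of_scalar_arith:
  "of_scalar (a + b) = of_scalar a + of_scalar b"
  "of_scalar (a - b) = of_scalar a - of_scalar b"
  "of_scalar 0 = 0"
  by (simp_all add: of_scalar_def single_add single_diff)

lemma scale_of_scalar: "scale c (of_scalar a) = of_scalar (c * a)"
  by (rule poly_mapping_eqI) (simp add: of_scalar_def lookup_single when_def)

lemma W_q_scalar_elem: "W_q qop (of_scalar c \<otimes> of_elem y) = of_scalar c"
proof -
  have "is_linear (\<lambda>u. W_q qop (u \<otimes> of_elem y))"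
    by (intro linear_comp[OF linear_W_q] lin_intros)
  then have "W_q qop (scale c (of_scalar 1) \<otimes> of_elem y)
      = scale c (W_q qop (of_scalar 1 \<otimes> of_elem y))"
    unfolding is_linear_iff by blast
  then show ?thesis
    by (simp add: scale_of_scalar)
qed

text \<open>
  This removes the fourth term of the differential, whose right factor is a value of \<open>\<theta>'\<close> and so
  a scalar.
\<close>

lemma W_q_scalar_right: "W_q qop (w \<otimes> of_scalar c) = 0"
proof -
  have unit: "(\<lambda>w. W_q qop (w \<otimes> of_scalar 1)) = (\<lambda>_. 0)"
  proof (rule linear_eq_on_bvec)
    show "is_linear (\<lambda>w. W_q qop (w \<otimes> of_scalar 1))"
      by (intro linear_comp[OF linear_W_q] lin_intros)
    show "W_q qop (bvec b \<otimes> of_scalar 1) = 0" for b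
      by (cases b) (simp_all add: bvec_option)
  qed (simp add: is_linear_iff)
  have "is_linear (\<lambda>v. W_q qop (w \<otimes> v))"
    by (intro linear_comp[OF linear_W_q] lin_intros)
  then have "W_q qop (w \<otimes> scale c (of_scalar 1)) = scale c (W_q qop (w \<otimes> of_scalar 1))"
    unfolding is_linear_iff by blast
  then show ?thesis
    by (simp add: scale_of_scalar unit[THEN fun_cong])
qed

theorem theorem7p4:
  fixes qop :: "'x \<Rightarrow> 'x \<Rightarrow> 'x"
    and \<theta> :: "'x \<Rightarrow> 'x \<Rightarrow> 'x \<Rightarrow> 'k::field"
  assumes "quandle qop"
    and "quandle_3cocycle qop \<theta>"
  shows "shelf_3cocycle qop (theta_hat \<theta>)"
  unfolding shelf_3cocycle_def
proof
  let ?D = "d31 W_comult (W_q qop) (theta_hat \<theta>)"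
  note evals = d31_W_bvec bvec_option tensor_zero linear_zero[OF linear_W_q]
    linear_zero[OF linear_theta_hat] W_q_scalar_elem W_q_scalar_right
  show "?D = (\<lambda>_. 0)"
  proof (rule linear_eq_on_bvec)
    show "is_linear ?D"
      by (simp add: d31_def tensor_lift4_def linear_lin_ext)
    show "is_linear (\<lambda>_. 0)"
      by (simp add: is_linear_iff)
    show "?D (bvec p) = 0" for p
    proof -
      obtain a b c d where p: "p = (a, b, c, d)"
        by (cases p)
      consider (elems) x y z w where "a = Some x" "b = Some y" "c = Some z" "d = Some w"
        | (unit_first) y z w where "a = None" "b = Some y" "c = Some z" "d = Some w"
        | (unit_later) "b = None \<or> c = None \<or> d = None"
        by (cases a; cases b; cases c; cases d) auto
      then show ?thesis
      proof cases
        case elems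
        have "\<theta> x y z + \<theta> (qop x z) (qop y z) w + \<theta> x z w
            = \<theta> (qop x y) z w + \<theta> x y w + \<theta> (qop x w) (qop y w) (qop z w)"
          using assms(2) by (simp add: quandle_3cocycle_def)
        then have "of_scalar (\<theta> x y z + \<theta> (qop x z) (qop y z) w + \<theta> x z w
            - \<theta> (qop x y) z w - \<theta> x y w - \<theta> (qop x w) (qop y w) (qop z w)) = (0 :: 'x option \<Rightarrow>\<^sub>0 'k)"
          by (simp add: of_scalar_arith(3))
        then show ?thesis
          by (simp add: p elems evals of_scalar_arith)
      next
        case unit_first
        then show ?thesis
          by (simp add: p evals)
      next
        case unit_later
        then show ?thesis
          by (cases a; cases b; cases c; cases d) (simp_all add: p evals)
      qed
    qed
  qed
qed (rule linear_theta_hat)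

end
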